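(* Let $\tau,\nu$ be consecutive patterns, let $\phi=\tau\text{-}\ell\text{-}\nu$ (resp. $\phi=\tau\text{-}1\text{-}\nu$) be a shuffle pattern, and let $f(\phi)=f_1(\tau)\text{-}\ell\text{-}f_2(\nu)$ (resp. $f(\phi)=f_1(\tau)\text{-}1\text{-}f_2(\nu)$), where $f_1,f_2\in\{R,I\}$ are any trivial bijections. Then $\phi\equiv f(\phi)$.
   Context: A composition $\sigma=\sigma_1\ldots\sigma_m$ of $n$ with $m$ parts in a finite set $A$ of positive integers is a sequence of $m$ elements of $A$ with sum $n$; the set of these is $C_{n;m}^A$. A partially ordered pattern (POP) is a word $\rho_1\ldots\rho_r$ of letters from a partially ordered alphabet (repeated letters allowed), possibly with dashes between some neighbouring letters. An occurrence of $\rho$ in $\sigma$ is a choice of positions $i_1<\cdots<i_r$ such that: $i_{p+1}=i_p+1$ whenever there is no dash between $\rho_p$ and $\rho_{p+1}$; $\sigma_{i_p}=\sigma_{i_q}$ whenever $\rho_p=\rho_q$; and $\sigma_{i_p}<\sigma_{i_q}$ whenever $\rho_p<\rho_q$. Nothing is required for incomparable letters. $\sigma$ avoids $\rho$ if it has no occurrence of $\rho$. Two POPs are equivalent, $\tau\equiv\phi$, if for every finite set $A$ of positive integers and all $n,m$ the number of compositions in $C_{n;m}^A$ that avoid $\tau$ equals the number that avoid $\phi$. A consecutive pattern is a dash-free word over a totally ordered alphabet $[t]=\{1,\dots,t\}$ that contains each letter of $[t]$ at least once. The shuffle pattern $\tau\text{-}\ell\text{-}\nu$ is the POP consisting of the word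 $\tau$, a dash, a single letter $\ell$, a dash, and the word $\nu$, where every letter of $\tau$ is incomparable to every letter of $\nu$, the order inside $\tau$ and inside $\nu$ is kept, and $\ell$ is greater than every letter of $\tau$ and of $\nu$. The shuffle pattern $\tau\text{-}1\text{-}\nu$ is defined in the same way, except that the middle letter is smaller than every letter of $\tau$ and of $\nu$. $R$ is the reversal, $R(w_1w_2\ldots w_r)=w_r\ldots w_2w_1$, and $I$ is the identity; these are the trivial bijections. *)

theory Defs
  imports Main
begin

definition compositions :: "nat set \<Rightarrow> nat \<Rightarrow> nat \<Rightarrow> nat list set" where
  "compositions A n m = {\<sigma>. length \<sigma> = m \<and> set \<sigma> \<subseteq> A \<and> sum_list \<sigma> = n}"

text \<open>
  Letters of a pattern word are indexed from 0, and \<open>p \<in> dashes \<rho>\<close> means that there is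
  a dash immediately before the letter with index \<open>p\<close>, so that \<open>dashes \<rho>\<close> is a subset of
  \<open>{1..<length (word \<rho>)}\<close>. The field \<open>before\<close> is the strict order of the alphabet.
\<close>

record 'a pop =
  word :: "'a list"
  dashes :: "nat set"
  before :: "'a \<Rightarrow> 'a \<Rightarrow> bool"

definition is_pop :: "'a pop \<Rightarrow> bool" where
  "is_pop \<rho> \<longleftrightarrow> irreflp (before \<rho>) \<and> transp (before \<rho>) \<and> dashes \<rho> \<subseteq> {1..<length (word \<rho>)}"

definition occurrence :: "'a pop \<Rightarrow> nat list \<Rightarrow> (nat \<Rightarrow> nat) \<Rightarrow> bool" where
  "occurrence \<rho> \<sigma> i \<longleftrightarrow>
     (let r = length (word \<rho>) in
       strict_mono_on {..<r} i \<and>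
       (\<forall>p<r. i p < length \<sigma>) \<and>
       (\<forall>p. Suc p < r \<and> Suc p \<notin> dashes \<rho> \<longrightarrow> i (Suc p) = Suc (i p)) \<and>
       (\<forall>p<r. \<forall>q<r. word \<rho> ! p = word \<rho> ! q \<longrightarrow> \<sigma> ! i p = \<sigma> ! i q) \<and>
       (\<forall>p<r. \<forall>q<r. before \<rho> (word \<rho> ! p) (word \<rho> ! q) \<longrightarrow> \<sigma> ! i p < \<sigma> ! i q))"

definition avoids :: "nat list \<Rightarrow> 'a pop \<Rightarrow> bool" where
  "avoids \<sigma> \<rho> \<longleftrightarrow> \<not> (\<exists>i. occurrence \<rho> \<sigma> i)"

definition pop_equiv :: "'a pop \<Rightarrow> 'b pop \<Rightarrow> bool" where
  "pop_equiv \<tau> \<phi> \<longleftrightarrow>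
     (\<forall>A n m. finite A \<and> 0 \<notin> A \<longrightarrow>
        card {\<sigma> \<in> compositions A n m. avoids \<sigma> \<tau>} = card {\<sigma> \<in> compositions A n m. avoids \<sigma> \<phi>})"

text \<open>
  The alphabet \<open>{1..t}\<close> is taken to be nonempty: a shuffle pattern has a letter on each side
  of each of its dashes.
\<close>

definition consecutive_pattern :: "nat list \<Rightarrow> bool" where
  "consecutive_pattern \<tau> \<longleftrightarrow> (\<exists>t\<ge>1. set \<tau> = {1..t})"

datatype shuffle_letter = Lft nat | Mid | Rgt nat

fun mid_greatest :: "shuffle_letter \<Rightarrow> shuffle_letter \<Rightarrow> bool" where
  "mid_greatest (Lft a) (Lft b) \<longleftrightarrow> a < b"
| "mid_greatest (Rgt a) (Rgt b) \<longleftrightarrow> a < b"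
| "mid_greatest (Lft a) Mid \<longleftrightarrow> True"
| "mid_greatest (Rgt a) Mid \<longleftrightarrow> True"
| "mid_greatest _ _ \<longleftrightarrow> False"

fun mid_least :: "shuffle_letter \<Rightarrow> shuffle_letter \<Rightarrow> bool" where
  "mid_least (Lft a) (Lft b) \<longleftrightarrow> a < b"
| "mid_least (Rgt a) (Rgt b) \<longleftrightarrow> a < b"
| "mid_least Mid (Lft b) \<longleftrightarrow> True"
| "mid_least Mid (Rgt b) \<longleftrightarrow> True"
| "mid_least _ _ \<longleftrightarrow> False"

definition shuffle_max :: "nat list \<Rightarrow> nat list \<Rightarrow> shuffle_letter pop" where
  "shuffle_max \<tau> \<nu> =
     \<lparr>word = map Lft \<tau> @ [Mid] @ map Rgt \<nu>,
      dashes = {length \<tau>, Suc (length \<tau>)},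
      before = mid_greatest\<rparr>"

definition shuffle_min :: "nat list \<Rightarrow> nat list \<Rightarrow> shuffle_letter pop" where
  "shuffle_min \<tau> \<nu> =
     \<lparr>word = map Lft \<tau> @ [Mid] @ map Rgt \<nu>,
      dashes = {length \<tau>, Suc (length \<tau>)},
      before = mid_least\<rparr>"

lemma consecutive_pattern_length: "consecutive_pattern \<tau> \<Longrightarrow> 0 < length \<tau>"
  by (auto simp: consecutive_pattern_def)

lemma is_pop_shuffle_max:
  assumes "consecutive_pattern \<tau>" and "consecutive_pattern \<nu>"
  shows "is_pop (shuffle_max \<tau> \<nu>)"
proof -
  have "irreflp mid_greatest"
    by (rule irreflpI, rename_tac x, case_tac x) auto
  moreover have "transp mid_greatest"
    by (rule transpI, rename_tac x y z, case_tac x; case_tac y; case_tac z) auto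
  ultimately show ?thesis
    using assms[THEN consecutive_pattern_length] by (auto simp: is_pop_def Suc_le_eq shuffle_max_def)
qed

lemma is_pop_shuffle_min:
  assumes "consecutive_pattern \<tau>" and "consecutive_pattern \<nu>"
  shows "is_pop (shuffle_min \<tau> \<nu>)"
proof -
  have "irreflp mid_least"
    by (rule irreflpI, rename_tac x, case_tac x) auto
  moreover have "transp mid_least"
    by (rule transpI, rename_tac x y z, case_tac x; case_tac y; case_tac z) auto
  ultimately show ?thesis
    using assms[THEN consecutive_pattern_length] by (auto simp: is_pop_def Suc_le_eq shuffle_min_def)
qed

end

theory Submission
  imports Defs "HOL-Library.Sublist" "HOL-Library.Multiset"
begin

text \<open>
  A composition contains \<open>\<tau>-\<ell>-\<nu>\<close> iff it splits as \<open>x v y\<close> such that \<open>x\<close> contains \<open>\<tau>\<close> and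
  \<open>y\<close> contains \<open>\<nu>\<close>, both on letters smaller than \<open>v\<close>. Take a word whose letters are at most
  \<open>n\<close> and cut it at the letters equal to \<open>n\<close> into blocks. Any two blocks are separated by a
  letter that dominates them, so the word avoids \<open>\<tau>-\<ell>-\<nu>\<close> iff every block does and no block
  containing \<open>\<nu>\<close> comes after another block containing \<open>\<tau>\<close>. Let \<open>u\<close> be the first block that
  contains \<open>\<tau>\<close>. The conditions then become: the blocks before \<open>u\<close> avoid \<open>\<tau>\<close> (true by choice),
  \<open>u\<close> avoids \<open>\<tau>-\<ell>-\<nu>\<close>, and the blocks after \<open>u\<close> avoid \<open>\<nu>\<close>. If there is no such \<open>u\<close>,
  the word avoids the shuffle pattern outright.

  This suggests a bijection that trades \<open>\<tau>\<close> for its reversal: reverse each block before \<open>u\<close>,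
  apply the bijection for smaller letters to \<open>u\<close>, and leave everything after \<open>u\<close> alone; if there
  is no \<open>u\<close>, reverse the whole word. The map \<open>flip\<close> does this. It only permutes letters
  (\<open>mset_flip\<close>), so it preserves compositions with given length, sum and letters; the map
  for the reversed pattern is its inverse (\<open>flip_flip\<close>); and it turns occurrences of
  \<open>\<tau>-\<ell>-\<nu>\<close> into occurrences with \<open>\<tau>\<close> reversed (\<open>shuffled_flip\<close>). For the recursion to
  work it must also preserve whether \<open>\<tau>\<close> occurs at all in the whole word, where the largest
  letter may take part; this is why a word without \<open>u\<close> is reversed as a whole and not block
  by block. Reversing entire compositions exchanges the two sides of the pattern, which reduces
  the reversal of \<open>\<nu>\<close> to that of \<open>\<tau>\<close>.

  Of the two sides, the argument uses only that containing them is inherited from factors to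
  words, so it is carried out for arbitrary properties of this kind. Letters are compared through
  a rank, so that \<open>\<tau>-1-\<nu>\<close> is the same statement for the rank \<open>n - z\<close> of a letter \<open>z\<close>.
\<close>

section \<open>Shuffles of two properties of words\<close>

locale ranked_letters =
  fixes rank :: "'a \<Rightarrow> nat"
begin

abbreviation bounded :: "nat \<Rightarrow> 'a list \<Rightarrow> bool" where
  "bounded n w \<equiv> \<forall>z\<in>set w. rank z < n"

definition below :: "('a list \<Rightarrow> bool) \<Rightarrow> nat \<Rightarrow> 'a list \<Rightarrow> bool" where
  "below L n w \<longleftrightarrow> (\<exists>b. sublist b w \<and> bounded n b \<and> L b)"

definition shuffled :: "('a list \<Rightarrow> bool) \<Rightarrow> ('a list \<Rightarrow> bool) \<Rightarrow> 'a list \<Rightarrow> bool" where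
  "shuffled L M w \<longleftrightarrow>
     (\<exists>x v y. w = x @ v # y \<and> below L (rank v) x \<and> below M (rank v) y)"

end

text \<open>
  The properties meant here are those of containing a given consecutive pattern.
\<close>

definition factor_monotone :: "('a list \<Rightarrow> bool) \<Rightarrow> bool" where
  "factor_monotone L \<longleftrightarrow> (\<forall>u w. sublist u w \<longrightarrow> L u \<longrightarrow> L w)"

lemma factor_monotoneD: "factor_monotone L \<Longrightarrow> L u \<Longrightarrow> sublist u w \<Longrightarrow> L w"
  unfolding factor_monotone_def by blast

definition mirror :: "('a list \<Rightarrow> bool) \<Rightarrow> 'a list \<Rightarrow> bool" where
  "mirror L w \<longleftrightarrow> L (rev w)"

lemma mirror_mirror: "mirror (mirror L) = L"
  by (simp add: mirror_def fun_eq_iff)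

lemma mirror_rev: "mirror L (rev w) \<longleftrightarrow> L w"
  by (simp add: mirror_def)

lemma factor_monotone_mirror:
  assumes "factor_monotone L"
  shows "factor_monotone (mirror L)"
  unfolding factor_monotone_def mirror_def
  using factor_monotoneD[OF assms] sublist_rev by blast

context ranked_letters
begin

lemma below_factor: "below L n u \<Longrightarrow> sublist u w \<Longrightarrow> below L n w"
  unfolding below_def using sublist_order.order_trans by blast

lemma below_mono: "below L m w \<Longrightarrow> m \<le> n \<Longrightarrow> below L n w"
  unfolding below_def by (meson less_le_trans)

lemma below_imp: "factor_monotone L \<Longrightarrow> below L n w \<Longrightarrow> L w"
  unfolding below_def by (blast dest: factor_monotoneD)

lemma below_bounded: "factor_monotone L \<Longrightarrow> bounded n w \<Longrightarrow> below L n w \<longleftrightarrow> L w"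
  using below_imp unfolding below_def by blast

lemma below_rev: "below (mirror L) n (rev w) \<longleftrightarrow> below L n w"
proof -
  have "below (mirror L) n (rev w)" if "below L n w" for L w
  proof -
    from that obtain b where "sublist b w" "bounded n b" "L b"
      unfolding below_def by blast
    then show ?thesis
      unfolding below_def by (intro exI[of _ "rev b"]) (simp add: mirror_def)
  qed
  from this[of L w] this[of "mirror L" "rev w"] show ?thesis
    by (auto simp: mirror_mirror)
qed

text \<open>
  A factor with letters of rank below \<open>n\<close> cannot straddle a letter of rank at least \<open>n\<close>.
\<close>

lemma below_append_Cons:
  assumes "\<not> rank v < n"
  shows "below L n (x @ v # y) \<longleftrightarrow> below L n x \<or> below L n y"
proof
  assume "below L n (x @ v # y)"
  then obtain b where b: "sublist b (x @ v # y)" "bounded n b" "L b"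
    unfolding below_def by blast
  with assms have "v \<notin> set b" by blast
  with b(1) have "sublist b x \<or> sublist b y"
    by (auto simp: sublist_append sublist_Cons_right prefix_Cons suffix_def)
  with b show "below L n x \<or> below L n y" unfolding below_def by blast
next
  have "sublist x (x @ v # y)" "sublist y (x @ v # y)"
    by (auto simp: sublist_append sublist_Cons_right)
  then show "below L n x \<or> below L n y \<Longrightarrow> below L n (x @ v # y)"
    by (blast intro: below_factor)
qed

lemma shuffled_rev: "shuffled L M (rev w) \<longleftrightarrow> shuffled (mirror M) (mirror L) w"
proof -
  have "shuffled (mirror M) (mirror L) (rev w)" if "shuffled L M w" for L M w
  proof -
    from that obtain x v y where "w = x @ v # y" "below L (rank v) x" "below M (rank v) y"
      unfolding shuffled_def by blast
    then have "rev w = rev y @ v # rev x" "below (mirror M) (rank v) (rev y)"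
      "below (mirror L) (rank v) (rev x)"
      by (simp_all add: below_rev)
    then show ?thesis unfolding shuffled_def by blast
  qed
  from this[of L M "rev w"] this[of "mirror M" "mirror L" w] show ?thesis
    by (auto simp: mirror_mirror)
qed

lemma shuffled_imp_below:
  assumes "shuffled L M w" and "bounded (Suc n) w"
  shows "below L n w" and "below M n w"
proof -
  from assms(1) obtain x v y where w: "w = x @ v # y" "below L (rank v) x" "below M (rank v) y"
    unfolding shuffled_def by blast
  with assms(2) have "rank v \<le> n" by auto
  moreover have "sublist x w" "sublist y w"
    unfolding w by (auto simp: sublist_append sublist_Cons_right)
  ultimately show "below L n w" "below M n w"
    using w(2,3) by (blast intro: below_mono below_factor)+
qed

lemma shuffled_factor:
  assumes "shuffled L M u"
  shows "shuffled L M (p @ u @ q)"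
proof -
  from assms obtain x v y where u: "u = x @ v # y" "below L (rank v) x" "below M (rank v) y"
    unfolding shuffled_def by blast
  then have "p @ u @ q = (p @ x) @ v # (y @ q)" "below L (rank v) (p @ x)" "below M (rank v) (y @ q)"
    by (auto intro: below_factor)
  then show ?thesis unfolding shuffled_def by blast
qed

text \<open>
  The recursion on which everything rests: \<open>v\<close> is the first letter of largest rank and \<open>u\<close> the
  block before it. If the left part lies in \<open>u\<close> and the right part in \<open>y\<close>, then the
  middle letter can be replaced by \<open>v\<close>, which dominates everything that the old middle letter did.
\<close>

lemma shuffled_append_Cons:
  assumes "factor_monotone L" and "bounded n u" and "rank v = n" and "bounded (Suc n) y"
  shows "shuffled L M (u @ v # y) \<longleftrightarrow>
    shuffled L M u \<or> L u \<and> below M n y \<or> shuffled L M y"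
proof
  assume "shuffled L M (u @ v # y)"
  then obtain x c z where w: "u @ v # y = x @ c # z"
    and L: "below L (rank c) x" and M: "below M (rank c) z"
    unfolding shuffled_def by blast
  have "u = x \<and> v = c \<and> y = z \<or> (\<exists>t. u = x @ c # t \<and> z = t @ v # y)
      \<or> (\<exists>t. x = u @ v # t \<and> y = t @ c # z)"
    using w by (auto simp: append_eq_append_conv2 Cons_eq_append_conv append_eq_Cons_conv)
  then consider (here) "u = x" "v = c" "y = z"
    | (left) t where "u = x @ c # t" "z = t @ v # y"
    | (right) t where "x = u @ v # t" "y = t @ c # z"
    by blast
  then show "shuffled L M u \<or> L u \<and> below M n y \<or> shuffled L M y"
  proof cases
    case here
    with L M assms below_imp show ?thesis by blast
  next
    case left
    with assms have c: "rank c < n" by simp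
    with M left have "below M (rank c) t \<or> below M (rank c) y"
      using below_append_Cons[of v "rank c" M t y] assms(3) by simp
    then show ?thesis
    proof
      assume "below M (rank c) t"
      with L left show ?thesis unfolding shuffled_def by blast
    next
      assume "below M (rank c) y"
      moreover have "L u"
        using L left assms(1) by (auto intro: factor_monotoneD below_imp)
      ultimately show ?thesis using c by (auto intro: below_mono)
    qed
  next
    case right
    with assms have c: "rank c \<le> n" by auto
    then have "below L (rank c) u \<or> below L (rank c) t"
      using L right below_append_Cons[of v "rank c" L u t] assms(3) by simp
    then show ?thesis
    proof
      assume "below L (rank c) t"
      with M right show ?thesis unfolding shuffled_def by blast
    next
      assume "below L (rank c) u"
      then have "L u" using assms(1) below_imp by blast
      moreover have "sublist z y" using right by (auto simp: sublist_append sublist_Cons_right)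
      ultimately show ?thesis using M c by (blast intro: below_mono below_factor)
    qed
  qed
next
  assume "shuffled L M u \<or> L u \<and> below M n y \<or> shuffled L M y"
  moreover have "shuffled L M (u @ v # y)" if "L u" "below M n y"
    using that below_bounded assms unfolding shuffled_def by blast
  ultimately show "shuffled L M (u @ v # y)"
    using shuffled_factor[of L M u "[]" "v # y"] shuffled_factor[of L M y "u @ [v]" "[]"]
    by auto
qed

section \<open>The bijection that reverses the left side\<close>

text \<open>
  Here \<open>L\<close> stands for containing \<open>\<tau>\<close>, words have letters of rank less than the numerical
  argument, and \<open>u\<close> is the first block between letters of rank \<open>n\<close>. The blocks are
  scanned from the left: those without \<open>\<tau>\<close> are reversed, and the first one with \<open>\<tau>\<close> is
  treated recursively and ends the scan. If \<open>L\<close> is inherited from factors, the scan cannot run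
  out of blocks, because it starts only when some block satisfies \<open>L\<close>.
\<close>

function flip :: "('a list \<Rightarrow> bool) \<Rightarrow> nat \<Rightarrow> 'a list \<Rightarrow> 'a list" where
  "flip L 0 w = w"
| "flip L (Suc n) w =
    (if \<not> below L n w then rev w
     else let u = takeWhile (\<lambda>z. rank z < n) w; q = dropWhile (\<lambda>z. rank z < n) w
       in if L u then flip L n u @ q
          else rev u @ (case q of [] \<Rightarrow> [] | v # y \<Rightarrow> v # flip L (Suc n) y))"
  by pat_completeness auto
termination
proof (relation "measures [\<lambda>(L, n, w). n, \<lambda>(L, n, w). length w]", goal_cases)
  case (3 L n w u q v y)
  then have "length (v # y) \<le> length w" using length_dropWhile_le by metis
  then show ?case by simp
qed auto

lemma flip_rev: "\<not> below L n w \<Longrightarrow> flip L (Suc n) w = rev w"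
  by simp

lemma flip_bounded:
  assumes "factor_monotone L" "bounded n u" "L u"
  shows "flip L (Suc n) u = flip L n u"
  using assms below_bounded[OF assms(1,2)]
  by (simp add: Let_def takeWhile_eq_all_conv[THEN iffD2] dropWhile_eq_Nil_conv[THEN iffD2])

lemma flip_first:
  assumes "factor_monotone L" "bounded n u" "L u" "rank v = n"
  shows "flip L (Suc n) (u @ v # y) = flip L n u @ v # y"
  using assms below_bounded[OF assms(1,2)] below_append_Cons[of v n L u y]
  by (simp add: Let_def)

lemma flip_skip:
  assumes "factor_monotone L" "bounded n u" "\<not> L u" "rank v = n" "below L n y"
  shows "flip L (Suc n) (u @ v # y) = rev u @ v # flip L (Suc n) y"
  using assms below_append_Cons[of v n L u y]
  by (subst flip.simps(2)) (simp add: Let_def del: flip.simps(2))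

text \<open>
  As a rewrite rule the unconditional equation would unfold \<open>flip\<close> forever. For a property
  inherited from factors, the four conditional ones above cover all words of rank less than \<open>Suc n\<close>.
\<close>

declare flip.simps(2) [simp del]

text \<open>
  The induction that follows the scan, with one case for each conditional equation of \<open>flip\<close>
  and one for the empty word, the only word of rank less than \<open>0\<close>.
\<close>

lemma flip_induct [consumes 2, case_names zero rev bounded first skip]:
  assumes L: "factor_monotone L" and "bounded n w"
    and zero: "P 0 []"
    and rev: "\<And>n w. bounded (Suc n) w \<Longrightarrow> \<not> below L n w \<Longrightarrow> P (Suc n) w"
    and bounded: "\<And>n u. bounded n u \<Longrightarrow> L u \<Longrightarrow> P n u \<Longrightarrow> P (Suc n) u"
    and first: "\<And>n u v y. bounded n u \<Longrightarrow> L u \<Longrightarrow> rank v = n \<Longrightarrow> bounded (Suc n) y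
      \<Longrightarrow> P n u \<Longrightarrow> P (Suc n) (u @ v # y)"
    and skip: "\<And>n u v y. bounded n u \<Longrightarrow> \<not> L u \<Longrightarrow> rank v = n \<Longrightarrow> bounded (Suc n) y
      \<Longrightarrow> below L n y \<Longrightarrow> P (Suc n) y \<Longrightarrow> P (Suc n) (u @ v # y)"
  shows "P n w"
  using \<open>bounded n w\<close>
proof (induction n arbitrary: w)
  case 0
  then show ?case using zero by (cases w) auto
next
  case (Suc n)
  note outer = Suc.IH
  from Suc.prems show ?case
  proof (induction w rule: length_induct)
    case (1 w)
    define u where "u = takeWhile (\<lambda>z. rank z < n) w"
    have u: "bounded n u" unfolding u_def by (auto dest: set_takeWhileD)
    show ?case
    proof (cases "below L n w")
      case False
      with rev 1 show ?thesis by blast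
    next
      case True
      show ?thesis
      proof (cases "dropWhile (\<lambda>z. rank z < n) w")
        case Nil
        then have "w = u" unfolding u_def using takeWhile_dropWhile_id by (metis append_Nil2)
        moreover from this True have "L u" using L below_imp by blast
        ultimately show ?thesis using bounded u outer by blast
      next
        case (Cons v y)
        then have w: "w = u @ v # y" unfolding u_def by (metis takeWhile_dropWhile_id)
        moreover have "\<not> rank v < n" using Cons by (simp add: dropWhile_eq_Cons_conv)
        ultimately have v: "rank v = n" and y: "bounded (Suc n) y"
          using 1 by auto
        show ?thesis
        proof (cases "L u")
          case True
          then show ?thesis unfolding w using first u v y outer by blast
        next
          case False
          with True have "below L n y"
            using below_append_Cons[of v n L u y] below_bounded[OF L u] v w by simp
          with False show ?thesis unfolding w using skip u v y 1 w by simp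
        qed
      qed
    qed
  qed
qed

lemma mset_flip:
  assumes "factor_monotone L" "bounded n w"
  shows "mset (flip L n w) = mset w"
  using assms
  by (induction n w rule: flip_induct)
    (simp_all add: flip_rev flip_bounded flip_first flip_skip assms(1))

lemma bounded_flip:
  assumes "factor_monotone L" "bounded n w"
  shows "bounded n (flip L n w)"
  using mset_eq_setD[OF mset_flip[OF assms]] assms(2) by simp

text \<open>
  Together with the next lemma, this says that the inverse scan takes the same branch at each step:
  the block at which it has to stop is again the first one in which the (reversed) pattern occurs.
\<close>

lemma flip_contains:
  assumes "factor_monotone L" "bounded n w" "L w"
  shows "mirror L (flip L n w)"
  using assms
proof (induction n w rule: flip_induct)
  case (first n u v y)
  then have "mirror L (flip L n u)" by blast
  then have "mirror L (flip L n u @ v # y)"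
    by (rule factor_monotoneD[OF factor_monotone_mirror[OF assms(1)]]) simp
  with first show ?case by (simp add: flip_first assms(1))
next
  case (skip n u v y)
  then have "mirror L (flip L (Suc n) y)"
    using below_imp[OF assms(1)] by blast
  then have "mirror L (rev u @ v # flip L (Suc n) y)"
    by (rule factor_monotoneD[OF factor_monotone_mirror[OF assms(1)]])
      (auto simp: sublist_append sublist_Cons_right)
  with skip show ?case by (simp add: flip_skip assms(1))
qed (simp_all add: flip_rev flip_bounded mirror_def assms(1))

lemma flip_below:
  assumes "factor_monotone L" "bounded (Suc n) w" "below L n w"
  shows "below (mirror L) n (flip L (Suc n) w)"
proof -
  \<comment> \<open>The induction is over the bound of the whole word, here called \<open>m = Suc n\<close>.\<close>
  have "below (mirror L) (m - 1) (flip L m w)" if "bounded m w" "below L (m - 1) w" "m > 0" for m w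
    using assms(1) that
  proof (induction m w rule: flip_induct)
    case (bounded n u)
    then have "mirror L (flip L n u)" using flip_contains assms(1) by blast
    with bounded show ?case
      using bounded_flip[OF assms(1)] below_bounded[OF factor_monotone_mirror[OF assms(1)]]
      by (simp add: flip_bounded assms(1))
  next
    case (first n u v y)
    then have "mirror L (flip L n u)" using flip_contains assms(1) by blast
    with first show ?case
      using bounded_flip[OF assms(1)] below_bounded[OF factor_monotone_mirror[OF assms(1)]]
      by (simp add: flip_first below_append_Cons assms(1))
  next
    case (skip n u v y)
    then show ?case
      by (simp add: flip_skip below_append_Cons assms(1))
  qed simp_all
  from this[of w "Suc n"] assms show ?thesis by simp
qed

lemma flip_flip:
  assumes "factor_monotone L" "bounded n w"
  shows "flip (mirror L) n (flip L n w) = w"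
  using assms
proof (induction n w rule: flip_induct)
  case (rev n w)
  then show ?case using below_rev[of L n w] by (simp add: flip_rev)
next
  case (bounded n u)
  then show ?case
    using flip_contains[OF assms(1)] bounded_flip[OF assms(1)] factor_monotone_mirror[OF assms(1)]
    by (simp add: flip_bounded assms(1))
next
  case (first n u v y)
  then show ?case
    using flip_contains[OF assms(1)] bounded_flip[OF assms(1)] factor_monotone_mirror[OF assms(1)]
    by (simp add: flip_first assms(1))
next
  case (skip n u v y)
  then show ?case
    using flip_below[OF assms(1)] factor_monotone_mirror[OF assms(1)]
    by (simp add: flip_skip mirror_rev assms(1))
qed simp

text \<open>
  Blocks before the chosen one do not satisfy \<open>L\<close> and their images do not satisfy \<open>mirror L\<close>, so
  only the chosen block and the unchanged part after it matter. Neither a word that is reversed as a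
  whole nor its image has an occurrence, because no block of it satisfies \<open>L\<close>.
\<close>

lemma shuffled_flip:
  assumes "factor_monotone L" "bounded n w"
  shows "shuffled (mirror L) M (flip L n w) \<longleftrightarrow> shuffled L M w"
  using assms
proof (induction n w rule: flip_induct)
  case (rev n w)
  then have "\<not> shuffled L M w" "\<not> shuffled (mirror L) M (List.rev w)"
    using shuffled_imp_below(1)[of _ M _ n] below_rev[of L n w] by auto
  with rev show ?case by (simp add: flip_rev)
next
  case (first n u v y)
  then have "bounded n (flip L n u)" "mirror L (flip L n u)"
    using flip_contains[OF assms(1)] bounded_flip[OF assms(1)] by auto
  with first show ?case
    using shuffled_imp_below(2)[of _ M y n] factor_monotone_mirror[OF assms(1)]
    by (auto simp: flip_first shuffled_append_Cons assms(1))
next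
  case (skip n u v y)
  have "bounded (Suc n) (flip L (Suc n) y)" using skip bounded_flip[OF assms(1)] by blast
  moreover have "\<not> shuffled L M u" "\<not> shuffled (mirror L) M (rev u)"
    using skip shuffled_imp_below(1)[of _ M _ n] below_rev[of L n u] below_imp[OF assms(1)]
    by (auto simp: less_Suc_eq)
  ultimately show ?case
    using skip factor_monotone_mirror[OF assms(1)]
    by (simp add: flip_skip mirror_rev shuffled_append_Cons assms(1))
qed (simp_all add: shuffled_def flip_bounded assms(1))

section \<open>Equinumerosity of words without a shuffle\<close>

definition mset_closed :: "'a list set \<Rightarrow> bool" where
  "mset_closed S \<longleftrightarrow> (\<forall>w w'. mset w = mset w' \<longrightarrow> w \<in> S \<longrightarrow> w' \<in> S)"

lemma card_not_shuffled_rev_left: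
  assumes "factor_monotone L" "mset_closed S" "\<And>w. w \<in> S \<Longrightarrow> bounded n w"
  shows "card {w \<in> S. \<not> shuffled L M w} = card {w \<in> S. \<not> shuffled (mirror L) M w}"
proof -
  have S: "flip K n w \<in> S" if "factor_monotone K" "w \<in> S" for K w
    using that assms(2,3) mset_flip[of K w n] unfolding mset_closed_def by metis
  note L' = factor_monotone_mirror[OF assms(1)]
  have "bij_betw (flip L n) {w \<in> S. \<not> shuffled L M w} {w \<in> S. \<not> shuffled (mirror L) M w}"
  proof (rule bij_betw_byWitness[where f' = "flip (mirror L) n"])
    show "\<forall>w\<in>{w \<in> S. \<not> shuffled L M w}. flip (mirror L) n (flip L n w) = w"
      using flip_flip[OF assms(1)] assms(3) by blast
    show "\<forall>w\<in>{w \<in> S. \<not> shuffled (mirror L) M w}. flip L n (flip (mirror L) n w) = w"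
      using flip_flip[OF L'] assms(3) unfolding mirror_mirror by blast
    show "flip L n ` {w \<in> S. \<not> shuffled L M w} \<subseteq> {w \<in> S. \<not> shuffled (mirror L) M w}"
      using S[OF assms(1)] shuffled_flip[OF assms(1)] assms(3) by blast
    show "flip (mirror L) n ` {w \<in> S. \<not> shuffled (mirror L) M w} \<subseteq> {w \<in> S. \<not> shuffled L M w}"
      using S[OF L'] shuffled_flip[OF L'] assms(3) by (auto simp: mirror_mirror)
  qed
  then show ?thesis by (rule bij_betw_same_card)
qed

lemma card_not_shuffled_reverse:
  assumes "mset_closed S"
  shows "card {w \<in> S. \<not> shuffled L M w} = card {w \<in> S. \<not> shuffled (mirror M) (mirror L) w}"
proof -
  have S: "rev w \<in> S \<longleftrightarrow> w \<in> S" for w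
    using assms unfolding mset_closed_def by (metis mset_rev)
  have "bij_betw rev {w \<in> S. \<not> shuffled L M w} {w \<in> S. \<not> shuffled (mirror M) (mirror L) w}"
    by (rule bij_betw_byWitness[where f' = rev]) (auto simp: S shuffled_rev mirror_mirror)
  then show ?thesis by (rule bij_betw_same_card)
qed

text \<open>
  Reversing all words makes the right side the left one, where it can be mirrored; reversing back
  restores the order.
\<close>

lemma card_not_shuffled_rev_right:
  assumes "factor_monotone M" "mset_closed S" "\<And>w. w \<in> S \<Longrightarrow> bounded n w"
  shows "card {w \<in> S. \<not> shuffled L M w} = card {w \<in> S. \<not> shuffled L (mirror M) w}"
  using card_not_shuffled_reverse[OF assms(2), of L M]
    card_not_shuffled_rev_left[OF factor_monotone_mirror[OF assms(1)] assms(2,3), of "mirror L"]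
    card_not_shuffled_reverse[OF assms(2), of L "mirror M"]
  by (simp add: mirror_mirror)

end

section \<open>Occurrences of shuffle patterns\<close>

definition matches_at :: "nat list \<Rightarrow> nat list \<Rightarrow> nat \<Rightarrow> bool" where
  "matches_at \<tau> \<sigma> s \<longleftrightarrow>
     (\<forall>p<length \<tau>. \<forall>q<length \<tau>.
        (\<tau> ! p = \<tau> ! q \<longrightarrow> \<sigma> ! (s + p) = \<sigma> ! (s + q)) \<and>
        (\<tau> ! p < \<tau> ! q \<longrightarrow> \<sigma> ! (s + p) < \<sigma> ! (s + q)))"

definition matches :: "nat list \<Rightarrow> nat list \<Rightarrow> bool" where
  "matches \<tau> b \<longleftrightarrow> length b = length \<tau> \<and> matches_at \<tau> b 0"

definition contains :: "nat list \<Rightarrow> nat list \<Rightarrow> bool" where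
  "contains \<tau> w \<longleftrightarrow> (\<exists>b. sublist b w \<and> matches \<tau> b)"

lemma factor_monotone_contains: "factor_monotone (contains \<tau>)"
  unfolding factor_monotone_def contains_def using sublist_order.order_trans by blast

lemma matches_rev: "matches \<tau> b \<Longrightarrow> matches (rev \<tau>) (rev b)"
  unfolding matches_def matches_at_def by (auto simp: rev_nth)

lemma contains_rev: "contains (rev \<tau>) = mirror (contains \<tau>)"
proof
  have rev: "contains (rev \<tau>) (rev w)" if "contains \<tau> w" for \<tau> w
    using that matches_rev sublist_rev unfolding contains_def by blast
  fix w
  show "contains (rev \<tau>) w \<longleftrightarrow> mirror (contains \<tau>) w"
    unfolding mirror_def using rev[of \<tau> "rev w"] rev[of "rev \<tau>" w] by auto
qed

text \<open>
  One may take the factor in \<open>below\<close> to be the occurrence of the pattern itself.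
\<close>

lemma below_contains:
  "ranked_letters.below rank (contains \<tau>) n w \<longleftrightarrow>
     (\<exists>b. sublist b w \<and> (\<forall>z\<in>set b. rank z < n) \<and> matches \<tau> b)"
proof
  assume "ranked_letters.below rank (contains \<tau>) n w"
  then obtain b c where "sublist b w" "\<forall>z\<in>set b. rank z < n" "sublist c b" "matches \<tau> c"
    unfolding ranked_letters.below_def contains_def by blast
  moreover from this have "sublist c w" "\<forall>z\<in>set c. rank z < n"
    using sublist_order.order_trans[of c b w] set_mono_sublist[of c b] by auto
  ultimately show "\<exists>b. sublist b w \<and> (\<forall>z\<in>set b. rank z < n) \<and> matches \<tau> b" by blast
next
  assume "\<exists>b. sublist b w \<and> (\<forall>z\<in>set b. rank z < n) \<and> matches \<tau> b"
  then show "ranked_letters.below rank (contains \<tau>) n w"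
    unfolding ranked_letters.below_def contains_def by blast
qed

lemma sublist_iff_take_drop:
  "sublist b w \<longleftrightarrow> (\<exists>s. s + length b \<le> length w \<and> b = take (length b) (drop s w))"
proof
  assume "sublist b w"
  then obtain x y where "w = x @ b @ y" unfolding sublist_def by blast
  then show "\<exists>s. s + length b \<le> length w \<and> b = take (length b) (drop s w)"
    by (intro exI[of _ "length x"]) simp
next
  assume "\<exists>s. s + length b \<le> length w \<and> b = take (length b) (drop s w)"
  then show "sublist b w"
    using sublist_order.order_trans[OF sublist_take sublist_drop] by metis
qed

lemma ex_factor_iff_matches_at:
  "(\<exists>b. sublist b w \<and> (\<forall>z\<in>set b. R z) \<and> matches \<tau> b) \<longleftrightarrow>
   (\<exists>s. s + length \<tau> \<le> length w \<and> (\<forall>p<length \<tau>. R (w ! (s + p))) \<and> matches_at \<tau> w s)"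
proof -
  have "(\<exists>b. sublist b w \<and> (\<forall>z\<in>set b. R z) \<and> matches \<tau> b) \<longleftrightarrow>
    (\<exists>b. length b = length \<tau> \<and> sublist b w \<and> (\<forall>z\<in>set b. R z) \<and> matches \<tau> b)"
    unfolding matches_def by blast
  also have "\<dots> \<longleftrightarrow>
    (\<exists>s. s + length \<tau> \<le> length w \<and> (\<forall>z\<in>set (take (length \<tau>) (drop s w)). R z)
       \<and> matches \<tau> (take (length \<tau>) (drop s w)))" (is "?A \<longleftrightarrow> ?B")
  proof
    assume ?A
    then show ?B unfolding sublist_iff_take_drop by metis
  next
    assume ?B
    then obtain s where "s + length \<tau> \<le> length w"
      "\<forall>z\<in>set (take (length \<tau>) (drop s w)). R z" "matches \<tau> (take (length \<tau>) (drop s w))"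
      by blast
    moreover have "sublist (take (length \<tau>) (drop s w)) w"
      using sublist_order.order_trans by blast
    ultimately show ?A by (intro exI[of _ "take (length \<tau>) (drop s w)"]) simp
  qed
  also have "\<dots> \<longleftrightarrow> (\<exists>s. s + length \<tau> \<le> length w \<and> (\<forall>p<length \<tau>. R (w ! (s + p))) \<and> matches_at \<tau> w s)"
    by (intro ex_cong1 conj_cong refl)
      (auto simp: all_set_conv_all_nth matches_def matches_at_def)
  finally show ?thesis .
qed

lemma all_less_split:
  "(\<forall>p<Suc (k + l). P p) \<longleftrightarrow> (\<forall>p<k. P p) \<and> P k \<and> (\<forall>q<l. P (Suc (k + q)))"
proof safe
  fix p
  assume "\<forall>p<k. P p" "P k" "\<forall>q<l. P (Suc (k + q))" "p < Suc (k + l)"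
  then show "P p"
    by (cases p k rule: linorder_cases) (auto dest!: less_imp_Suc_add)
qed auto

text \<open>
  The positions chosen by an occurrence of a shuffle pattern whose left side has length \<open>k\<close>: the
  left side starts at \<open>s\<close>, the middle letter is at \<open>j\<close>, and the right side starts at \<open>t\<close>.
\<close>

definition place :: "nat \<Rightarrow> nat \<Rightarrow> nat \<Rightarrow> nat \<Rightarrow> nat \<Rightarrow> nat" where
  "place k s j t p = (if p < k then s + p else if p = k then j else t + (p - Suc k))"

lemma place_simps [simp]:
  "p < k \<Longrightarrow> place k s j t p = s + p"
  "place k s j t k = j"
  "place k s j t (Suc (k + q)) = t + q"
  by (simp_all add: place_def)

lemma occurrence_cong:
  assumes "\<And>p. p < length (word \<rho>) \<Longrightarrow> i p = i' p"
  shows "occurrence \<rho> \<sigma> i \<longleftrightarrow> occurrence \<rho> \<sigma> i'"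
  using assms unfolding occurrence_def Let_def strict_mono_on_def
  by (auto simp: Suc_lessD)

text \<open>
  Within each side consecutive letters occupy consecutive positions, so an occurrence is determined
  by where the two sides start and where the middle letter is.
\<close>

lemma ex_occurrence_iff_place:
  assumes "length (word \<rho>) = Suc (k + l)" "dashes \<rho> = {k, Suc k}" "0 < k" "0 < l"
  shows "(\<exists>i. occurrence \<rho> \<sigma> i) \<longleftrightarrow>
    (\<exists>s j t. s + k \<le> j \<and> j < t \<and> t + l \<le> length \<sigma> \<and>
      (\<forall>p<Suc (k + l). \<forall>q<Suc (k + l). word \<rho> ! p = word \<rho> ! q \<longrightarrow>
         \<sigma> ! place k s j t p = \<sigma> ! place k s j t q) \<and>
      (\<forall>p<Suc (k + l). \<forall>q<Suc (k + l). before \<rho> (word \<rho> ! p) (word \<rho> ! q) \<longrightarrow>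
         \<sigma> ! place k s j t p < \<sigma> ! place k s j t q))"
    (is "_ \<longleftrightarrow> (\<exists>s j t. ?R s j t)")
proof
  assume "\<exists>i. occurrence \<rho> \<sigma> i"
  then obtain i where i: "occurrence \<rho> \<sigma> i" ..
  then have mono: "strict_mono_on {..<Suc (k + l)} i"
    and len: "\<And>p. p < Suc (k + l) \<Longrightarrow> i p < length \<sigma>"
    and step: "\<And>p. Suc p < Suc (k + l) \<Longrightarrow> Suc p \<noteq> k \<Longrightarrow> p \<noteq> k \<Longrightarrow> i (Suc p) = Suc (i p)"
    using assms(1,2) unfolding occurrence_def Let_def by auto
  have left: "i p = i 0 + p" if "p < k" for p
    using that by (induction p) (auto simp: step)
  have right: "i (Suc (k + q)) = i (Suc k) + q" if "q < l" for q
    using that by (induction q) (auto simp: step)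
  have eq: "i p = place k (i 0) (i k) (i (Suc k)) p" if "p < Suc (k + l)" for p
  proof (cases p k rule: linorder_cases)
    case greater
    then obtain q where "p = Suc (k + q)" using less_imp_Suc_add by blast
    with that right[of q] show ?thesis by simp
  next
    case less
    with left[of p] show ?thesis by simp
  next
    case equal
    then show ?thesis by simp
  qed
  define i' where "i' = place k (i 0) (i k) (i (Suc k))"
  have "occurrence \<rho> \<sigma> i'"
    using i occurrence_cong[of \<rho> i] eq unfolding assms(1) i'_def by blast
  moreover have "i 0 + k \<le> i k"
  proof -
    have "i (k - 1) < i k"
      using mono assms(3) by (simp add: strict_mono_on_def)
    moreover have "i (k - 1) = i 0 + (k - 1)" by (rule left) (use assms(3) in simp)
    ultimately show ?thesis using assms(3) by linarith
  qed
  moreover have "i k < i (Suc k)"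
    using mono assms(4) by (simp add: strict_mono_on_def)
  moreover have "i (Suc k) + l \<le> length \<sigma>"
  proof -
    have "i (Suc (k + (l - 1))) < length \<sigma>" by (rule len) (use assms(4) in simp)
    moreover have "i (Suc (k + (l - 1))) = i (Suc k) + (l - 1)"
      by (rule right) (use assms(4) in simp)
    ultimately show ?thesis using assms(4) by linarith
  qed
  ultimately have "?R (i 0) (i k) (i (Suc k))"
    unfolding occurrence_def Let_def assms(1) i'_def by blast
  then show "\<exists>s j t. ?R s j t" by blast
next
  assume "\<exists>s j t. ?R s j t"
  then obtain s j t where R: "?R s j t" by blast
  then have stj: "s + k \<le> j" "j < t" "t + l \<le> length \<sigma>" by blast+
  have "strict_mono_on {..<Suc (k + l)} (place k s j t)"
    using stj unfolding strict_mono_on_def place_def by auto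
  moreover have "\<forall>p<Suc (k + l). place k s j t p < length \<sigma>"
    using stj unfolding place_def by auto
  moreover have "\<forall>p. Suc p < Suc (k + l) \<and> Suc p \<notin> {k, Suc k} \<longrightarrow>
      place k s j t (Suc p) = Suc (place k s j t p)"
    unfolding place_def by auto
  ultimately have "occurrence \<rho> \<sigma> (place k s j t)"
    using R unfolding occurrence_def Let_def assms(1,2) by blast
  then show "\<exists>i. occurrence \<rho> \<sigma> i" by blast
qed

text \<open>
  The relation \<open>R\<close> is \<open>(<)\<close> for a greatest and \<open>(>)\<close> for a least middle letter; the sides
  themselves are always compared with \<open>(<)\<close>.
\<close>

definition shuffled_at ::
  "(nat \<Rightarrow> nat \<Rightarrow> bool) \<Rightarrow> nat list \<Rightarrow> nat list \<Rightarrow> nat list \<Rightarrow> nat \<Rightarrow> nat \<Rightarrow> nat \<Rightarrow> bool" where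
  "shuffled_at R \<tau> \<nu> \<sigma> s j t \<longleftrightarrow>
     s + length \<tau> \<le> j \<and> j < t \<and> t + length \<nu> \<le> length \<sigma> \<and>
     matches_at \<tau> \<sigma> s \<and> (\<forall>p<length \<tau>. R (\<sigma> ! (s + p)) (\<sigma> ! j)) \<and>
     matches_at \<nu> \<sigma> t \<and> (\<forall>q<length \<nu>. R (\<sigma> ! (t + q)) (\<sigma> ! j))"

lemma avoids_shuffle_max:
  assumes "\<tau> \<noteq> []" "\<nu> \<noteq> []"
  shows "avoids \<sigma> (shuffle_max \<tau> \<nu>) \<longleftrightarrow> (\<nexists>s j t. shuffled_at (<) \<tau> \<nu> \<sigma> s j t)"
proof -
  let ?\<rho> = "shuffle_max \<tau> \<nu>"
  have "length (word ?\<rho>) = Suc (length \<tau> + length \<nu>)"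
    "dashes ?\<rho> = {length \<tau>, Suc (length \<tau>)}" "0 < length \<tau>" "0 < length \<nu>"
    using assms by (simp_all add: shuffle_max_def)
  note iff = ex_occurrence_iff_place[OF this]
  show ?thesis
    unfolding avoids_def iff
  proof (intro arg_cong[where f = Not] ex_cong1, goal_cases)
    case (1 s j t)
    show ?case
      unfolding all_less_split shuffled_at_def matches_at_def
      by (simp add: shuffle_max_def nth_append) blast
  qed
qed

lemma avoids_shuffle_min:
  assumes "\<tau> \<noteq> []" "\<nu> \<noteq> []"
  shows "avoids \<sigma> (shuffle_min \<tau> \<nu>) \<longleftrightarrow> (\<nexists>s j t. shuffled_at (>) \<tau> \<nu> \<sigma> s j t)"
proof -
  let ?\<rho> = "shuffle_min \<tau> \<nu>"
  have "length (word ?\<rho>) = Suc (length \<tau> + length \<nu>)"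
    "dashes ?\<rho> = {length \<tau>, Suc (length \<tau>)}" "0 < length \<tau>" "0 < length \<nu>"
    using assms by (simp_all add: shuffle_min_def)
  note iff = ex_occurrence_iff_place[OF this]
  show ?thesis
    unfolding avoids_def iff
  proof (intro arg_cong[where f = Not] ex_cong1, goal_cases)
    case (1 s j t)
    show ?case
      unfolding all_less_split shuffled_at_def matches_at_def
      by (simp add: shuffle_min_def nth_append) blast
  qed
qed

lemma ex_shuffled_at_iff:
  assumes R: "\<And>y z. y \<in> set \<sigma> \<Longrightarrow> z \<in> set \<sigma> \<Longrightarrow> R y z \<longleftrightarrow> rank y < rank z"
  shows "(\<exists>s j t. shuffled_at R \<tau> \<nu> \<sigma> s j t) \<longleftrightarrow>
    ranked_letters.shuffled rank (contains \<tau>) (contains \<nu>) \<sigma>"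
proof -
  interpret ranked_letters rank .
  have left: "below (contains \<tau>) (rank (\<sigma> ! j)) (take j \<sigma>) \<longleftrightarrow>
    (\<exists>s. s + length \<tau> \<le> j \<and> matches_at \<tau> \<sigma> s \<and> (\<forall>p<length \<tau>. R (\<sigma> ! (s + p)) (\<sigma> ! j)))"
    if "j < length \<sigma>" for j
    unfolding below_contains ex_factor_iff_matches_at
  proof (intro ex_cong1, goal_cases)
    case (1 s)
    have "R (\<sigma> ! (s + p)) (\<sigma> ! j) \<longleftrightarrow> rank (take j \<sigma> ! (s + p)) < rank (\<sigma> ! j)"
      if "s + length \<tau> \<le> j" "p < length \<tau>" for p
      using that \<open>j < length \<sigma>\<close> R[of "\<sigma> ! (s + p)" "\<sigma> ! j"] by simp
    moreover have "matches_at \<tau> (take j \<sigma>) s \<longleftrightarrow> matches_at \<tau> \<sigma> s" if "s + length \<tau> \<le> j"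
      using that unfolding matches_at_def by simp
    moreover have "length (take j \<sigma>) = j" using \<open>j < length \<sigma>\<close> by simp
    ultimately show ?case by metis
  qed
  have right: "below (contains \<nu>) (rank (\<sigma> ! j)) (drop (Suc j) \<sigma>) \<longleftrightarrow>
    (\<exists>t. j < t \<and> t + length \<nu> \<le> length \<sigma> \<and> matches_at \<nu> \<sigma> t \<and>
       (\<forall>q<length \<nu>. R (\<sigma> ! (t + q)) (\<sigma> ! j)))"
    if "j < length \<sigma>" for j
  proof -
    have "(\<exists>t. j < t \<and> P t) \<longleftrightarrow> (\<exists>s. P (Suc j + s))" for P
      using less_iff_Suc_add by auto
    then show ?thesis
      unfolding below_contains ex_factor_iff_matches_at
    proof (simp only:, intro ex_cong1, goal_cases)
      case (1 s)
      have "R (\<sigma> ! (Suc j + s + q)) (\<sigma> ! j) \<longleftrightarrow>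
          rank (drop (Suc j) \<sigma> ! (s + q)) < rank (\<sigma> ! j)"
        if "Suc j + s + length \<nu> \<le> length \<sigma>" "q < length \<nu>" for q
        using that \<open>j < length \<sigma>\<close> R[of "\<sigma> ! (Suc j + s + q)" "\<sigma> ! j"] by (simp add: ac_simps)
      moreover have "matches_at \<nu> (drop (Suc j) \<sigma>) s \<longleftrightarrow> matches_at \<nu> \<sigma> (Suc j + s)"
        if "Suc j + s + length \<nu> \<le> length \<sigma>"
        using that unfolding matches_at_def by (simp add: ac_simps)
      moreover have "s + length \<nu> \<le> length (drop (Suc j) \<sigma>) \<longleftrightarrow>
          Suc j + s + length \<nu> \<le> length \<sigma>"
        using \<open>j < length \<sigma>\<close> by auto
      ultimately show ?case by metis
    qed
  qed
  have "shuffled (contains \<tau>) (contains \<nu>) \<sigma> \<longleftrightarrow>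
    (\<exists>j<length \<sigma>. below (contains \<tau>) (rank (\<sigma> ! j)) (take j \<sigma>) \<and>
       below (contains \<nu>) (rank (\<sigma> ! j)) (drop (Suc j) \<sigma>))" (is "?A \<longleftrightarrow> ?B")
  proof
    assume ?A
    then obtain x v y where "\<sigma> = x @ v # y" "below (contains \<tau>) (rank v) x"
      "below (contains \<nu>) (rank v) y"
      unfolding shuffled_def by blast
    then show ?B by (intro exI[of _ "length x"]) simp
  next
    assume ?B
    then show ?A unfolding shuffled_def using id_take_nth_drop by blast
  qed
  also have "\<dots> \<longleftrightarrow> (\<exists>j<length \<sigma>.
      (\<exists>s. s + length \<tau> \<le> j \<and> matches_at \<tau> \<sigma> s \<and>
         (\<forall>p<length \<tau>. R (\<sigma> ! (s + p)) (\<sigma> ! j))) \<and>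
      (\<exists>t. j < t \<and> t + length \<nu> \<le> length \<sigma> \<and> matches_at \<nu> \<sigma> t \<and>
         (\<forall>q<length \<nu>. R (\<sigma> ! (t + q)) (\<sigma> ! j))))"
    by (intro ex_cong1 conj_cong refl left right)
  also have "\<dots> \<longleftrightarrow> (\<exists>s j t. shuffled_at R \<tau> \<nu> \<sigma> s j t)"
  proof -
    have "j < length \<sigma>" if "j < t" "t + length \<nu> \<le> length \<sigma>" for j t
      using that by linarith
    then show ?thesis unfolding shuffled_at_def by blast
  qed
  finally show ?thesis by blast
qed

section \<open>Equivalence of the shuffle patterns\<close>

text \<open>
  The parts of a composition of \<open>n\<close> are at most \<open>n\<close>, so \<open>R\<close> has to be given by a rank on
  these letters only; this makes a rank for \<open>(>)\<close> possible.
\<close>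

lemma card_not_shuffled_at:
  fixes \<tau> \<nu> :: "nat list" and rank :: "nat \<Rightarrow> nat"
  assumes f: "f \<in> {rev, id}" "g \<in> {rev, id}"
    and R: "\<And>y z. y \<le> n \<Longrightarrow> z \<le> n \<Longrightarrow> R y z \<longleftrightarrow> rank y < rank z"
    and rank: "\<And>z. z \<le> n \<Longrightarrow> rank z < N"
  shows "card {\<sigma> \<in> compositions A n m. \<nexists>s j t. shuffled_at R \<tau> \<nu> \<sigma> s j t} =
    card {\<sigma> \<in> compositions A n m. \<nexists>s j t. shuffled_at R (f \<tau>) (g \<nu>) \<sigma> s j t}"
proof -
  interpret ranked_letters rank .
  have le: "z \<le> n" if "\<sigma> \<in> compositions A n m" "z \<in> set \<sigma>" for \<sigma> z
    using that member_le_sum_list[of z \<sigma>] unfolding compositions_def by auto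
  have closed: "mset_closed (compositions A n m)"
    unfolding mset_closed_def compositions_def
    by (auto dest: mset_eq_length mset_eq_setD) (metis sum_mset_sum_list)
  have bounded: "bounded N \<sigma>" if "\<sigma> \<in> compositions A n m" for \<sigma>
    using le that rank by blast
  have sets: "{\<sigma> \<in> compositions A n m. \<nexists>s j t. shuffled_at R \<tau> \<nu> \<sigma> s j t} =
      {\<sigma> \<in> compositions A n m. \<not> shuffled (contains \<tau>) (contains \<nu>) \<sigma>}"
    for \<tau> \<nu>
    using ex_shuffled_at_iff[where R = R and rank = rank] R le by blast
  have "card {\<sigma> \<in> compositions A n m. \<not> shuffled (contains \<tau>) (contains \<nu>) \<sigma>} =
      card {\<sigma> \<in> compositions A n m. \<not> shuffled (contains (f \<tau>)) (contains \<nu>) \<sigma>}"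
    using f(1) card_not_shuffled_rev_left[OF factor_monotone_contains closed bounded, of \<tau>]
    by (auto simp: contains_rev)
  also have "\<dots> = card {\<sigma> \<in> compositions A n m. \<not> shuffled (contains (f \<tau>)) (contains (g \<nu>)) \<sigma>}"
    using f(2) card_not_shuffled_rev_right[OF factor_monotone_contains closed bounded, of _ \<nu>]
    by (auto simp: contains_rev)
  finally show ?thesis unfolding sets .
qed

theorem corollary3p5:
  fixes \<tau> \<nu> :: "nat list" and f\<^sub>1 f\<^sub>2 :: "nat list \<Rightarrow> nat list"
  assumes "consecutive_pattern \<tau>" and "consecutive_pattern \<nu>"
    and "f\<^sub>1 \<in> {rev, id}" and "f\<^sub>2 \<in> {rev, id}"
  shows "pop_equiv (shuffle_max \<tau> \<nu>) (shuffle_max (f\<^sub>1 \<tau>) (f\<^sub>2 \<nu>)) \<and>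
         pop_equiv (shuffle_min \<tau> \<nu>) (shuffle_min (f\<^sub>1 \<tau>) (f\<^sub>2 \<nu>))"
proof -
  have ne: "\<tau> \<noteq> []" "\<nu> \<noteq> []"
    using assms(1,2)[THEN consecutive_pattern_length] by auto
  then have ne': "f\<^sub>1 \<tau> \<noteq> []" "f\<^sub>2 \<nu> \<noteq> []" using assms(3,4) by auto
  have "pop_equiv (shuffle_max \<tau> \<nu>) (shuffle_max (f\<^sub>1 \<tau>) (f\<^sub>2 \<nu>))"
    unfolding pop_equiv_def avoids_shuffle_max[OF ne] avoids_shuffle_max[OF ne']
    by (intro allI impI card_not_shuffled_at[OF assms(3,4),
          where rank = "\<lambda>z. z" and N = "Suc n" and n = n for n]) auto
  moreover have "pop_equiv (shuffle_min \<tau> \<nu>) (shuffle_min (f\<^sub>1 \<tau>) (f\<^sub>2 \<nu>))"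
    unfolding pop_equiv_def avoids_shuffle_min[OF ne] avoids_shuffle_min[OF ne']
  proof (intro allI impI)
    fix A n m
    show "card {\<sigma> \<in> compositions A n m. \<nexists>s j t. shuffled_at (>) \<tau> \<nu> \<sigma> s j t} =
      card {\<sigma> \<in> compositions A n m. \<nexists>s j t. shuffled_at (>) (f\<^sub>1 \<tau>) (f\<^sub>2 \<nu>) \<sigma> s j t}"
      by (rule card_not_shuffled_at[OF assms(3,4), where rank = "\<lambda>z. n - z" and N = "Suc n"])
        auto
  qed
  ultimately show ?thesis ..
qed

end
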